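(* Suppose that the Manickam--Miklós--Singhi conjecture is true, i.e. that for all positive integers $n,k$ with $n\ge 4k$ and all real numbers $x_1,\dots,x_n$ with $\sum_{i=1}^n x_i=0$, at least $\binom{n-1}{k-1}$ of the $k$-element subsets $S\subseteq\{1,\dots,n\}$ satisfy $\sum_{i\in S}x_i\ge 0$. Then for every real $p$ with $0\le p\le 1/4$, every positive integer $m$, every $w\in\mathbb{R}_{>0}^m$ with $\sum_{i=1}^m w_i=1$, and $v=(v_1,\dots,v_m)\in\{0,1\}^m$ a random vector with i.i.d. Bernoulli$(p)$ coordinates, one has \[\mathbb{P}[\langle v,w\rangle\ge p]\ge p.\]
   Context: Here $\langle v,w\rangle=\sum_{i=1}^m w_iv_i$, and Bernoulli$(p)$ means taking value $1$ with probability $p$ and value $0$ with probability $1-p$. *)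

theory Defs
  imports "HOL-Probability.Probability"
begin

definition MMS_conjecture :: bool where
  "MMS_conjecture \<longleftrightarrow>
     (\<forall>(n::nat) (k::nat) (x :: nat \<Rightarrow> real).
        n > 0 \<longrightarrow> k > 0 \<longrightarrow> n \<ge> 4 * k \<longrightarrow> (\<Sum>i=1..n. x i) = 0 \<longrightarrow>
        card {S. S \<subseteq> {1..n} \<and> card S = k \<and> (\<Sum>i\<in>S. x i) \<ge> 0} \<ge> (n - 1) choose (k - 1))"

(* Real-valued rather than bool-valued (as in bernoulli_pmf), so that the coordinates can be
   paired with a real vector. The values are required to be 0 or 1 everywhere, not only almost
   surely. *)
definition bernoulli_var :: "'a measure \<Rightarrow> real \<Rightarrow> ('a \<Rightarrow> real) \<Rightarrow> bool" where
  "bernoulli_var M p X \<longleftrightarrow>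
     X \<in> borel_measurable M \<and>
     (\<forall>\<omega>\<in>space M. X \<omega> \<in> {0, 1}) \<and>
     measure M {\<omega> \<in> space M. X \<omega> = 1} = p \<and>
     measure M {\<omega> \<in> space M. X \<omega> = 0} = 1 - p"

end

theory Submission
  imports Defs
begin

text \<open>
  Pad the weights with zeros to length \<open>n\<close> and apply the conjecture to \<open>x i = w i - 1/n\<close>: a
  uniformly random \<open>k\<close>-subset of \<open>{1..n}\<close> has \<open>w\<close>-weight at least \<open>k/n\<close> with probability at
  least \<open>k/n\<close>. As \<open>n\<close> grows with \<open>k/n\<close> tending to \<open>p\<close> from above, the trace of the random subset
  on \<open>{1..m}\<close> converges in distribution to \<open>m\<close> independent Bernoulli(\<open>p\<close>) choices. Approaching \<open>p\<close>
  from above makes the event \<open>w(T) \<ge> k/n\<close> imply \<open>w(T) \<ge> p\<close>; taking \<open>n = 4 j\<close> and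
  \<open>k = \<lceil>p n\<rceil>\<close> keeps \<open>n \<ge> 4 k\<close>.
\<close>

section \<open>Binomial counts of subsets with a given trace, and their limits\<close>

text \<open>Only \<open>S - V\<close> is free, since \<open>S\<close> must agree with
  \<open>T\<close> on \<open>V\<close>. For \<open>card T > k\<close> the truncated difference would
  give the count 1 although no such \<open>S\<close> exists, hence the bound on
  \<open>card T\<close>.\<close>

lemma card_subsets_with_trace:
  assumes "finite U" "V \<subseteq> U" "T \<subseteq> V" "card T \<le> k"
  shows "card {S. S \<subseteq> U \<and> card S = k \<and> S \<inter> V = T} = card (U - V) choose (k - card T)"
proof -
  have fin: "finite S" if "S \<subseteq> U" for S
    using assms(1) that by (rule rev_finite_subset)
  have cardT: "card (R \<union> T) = card R + card T" if "R \<subseteq> U - V" for R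
    using that assms by (intro card_Un_disjoint fin) auto
  have "bij_betw (\<lambda>R. R \<union> T) {R. R \<subseteq> U - V \<and> card R = k - card T}
          {S. S \<subseteq> U \<and> card S = k \<and> S \<inter> V = T}"
  proof (rule bij_betw_byWitness[where f' = "\<lambda>S. S - V"])
    show "\<forall>R\<in>{R. R \<subseteq> U - V \<and> card R = k - card T}. R \<union> T - V = R"
      using assms by auto
    show "\<forall>S\<in>{S. S \<subseteq> U \<and> card S = k \<and> S \<inter> V = T}. S - V \<union> T = S"
      by auto
    show "(\<lambda>R. R \<union> T) ` {R. R \<subseteq> U - V \<and> card R = k - card T}
            \<subseteq> {S. S \<subseteq> U \<and> card S = k \<and> S \<inter> V = T}"
      using assms by (auto simp: cardT)
    show "(\<lambda>S. S - V) ` {S. S \<subseteq> U \<and> card S = k \<and> S \<inter> V = T}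
            \<subseteq> {R. R \<subseteq> U - V \<and> card R = k - card T}"
    proof clarsimp
      fix S assume S: "S \<subseteq> U"
      have "S - V = S - S \<inter> V" by auto
      then show "S - V \<subseteq> U - V \<and> card (S - V) = card S - card (S \<inter> V)"
        using S card_Diff_subset[of "S \<inter> V" S] fin[OF S] by auto
    qed
  qed
  then have "card {S. S \<subseteq> U \<and> card S = k \<and> S \<inter> V = T}
      = card {R. R \<subseteq> U - V \<and> card R = k - card T}"
    by (rule bij_betw_same_card[THEN sym])
  also have "\<dots> = card (U - V) choose (k - card T)"
    using assms(1) by (simp add: n_subsets)
  finally show ?thesis .
qed

text \<open>This is the absorption identity: the chance that a random \<open>Suc k\<close>-subset of
  \<open>Suc n\<close> points contains a given point.\<close>

lemma binomial_ratio_Suc_Suc: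
  "real (n choose k) / real (Suc n choose Suc k) = real (Suc k) / real (Suc n)" if "k \<le> n"
proof -
  have "real (Suc k) * real (Suc n choose Suc k) = real (Suc n) * real (n choose k)"
    using Suc_times_binomial[of k n] by (metis of_nat_mult)
  moreover have "Suc n choose Suc k > 0"
    using that by (intro zero_less_binomial) simp
  ultimately show ?thesis
    by (simp add: frac_eq_eq mult.commute del: binomial_Suc_Suc of_nat_Suc)
qed

text \<open>The complementary chance, that a given point is missed. It follows from the previous
  ratio by passing to complements of subsets.\<close>

lemma binomial_ratio_Suc:
  "real (n choose k) / real (Suc n choose k) = real (Suc n - k) / real (Suc n)" if "k \<le> n"
proof -
  have *: "Suc n choose (Suc n - k) = Suc n choose k" "n choose (n - k) = n choose k"
    using that by (auto intro: binomial_symmetric[symmetric])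
  have "Suc n - k = Suc (n - k)"
    using that by simp
  then show ?thesis
    using binomial_ratio_Suc_Suc[of "n - k" n] * by (simp del: binomial_Suc_Suc)
qed

text \<open>Eventually the ratio is the chance that a random \<open>k j\<close>-subset of
  \<open>n j\<close> points meets \<open>m\<close> fixed points in a prescribed set of size
  \<open>t\<close>. The induction on \<open>m\<close> reveals the fixed points one at a time: each
  is hit with limiting chance \<open>p\<close> and missed with limiting chance
  \<open>1 - p\<close>.\<close>

lemma binomial_ratio_tendsto:
  fixes n k :: "'b \<Rightarrow> nat" and p :: real
  assumes n: "filterlim n at_top F" and kn: "((\<lambda>j. real (k j) / real (n j)) \<longlongrightarrow> p) F"
    and p: "0 < p" "p < 1" and "t \<le> m"
  shows "((\<lambda>j. real ((n j - m) choose (k j - t)) / real (n j choose k j))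
            \<longlongrightarrow> p ^ t * (1 - p) ^ (m - t)) F"
proof -
  have nr: "filterlim (\<lambda>j. real (n j)) at_top F"
    using filterlim_compose[OF filterlim_real_sequentially n] .
  have n0: "eventually (\<lambda>j. n j > 0) F"
    using nr by (auto simp: filterlim_at_top_dense dest: spec[of _ 0])
  \<comment> \<open>As \<open>0 < p < 1\<close>, both \<open>k j\<close> and
    \<open>n j - k j\<close> are unbounded, so eventually none of the natural-number subtractions
    below truncates.\<close>
  have kr: "filterlim (\<lambda>j. real (k j)) at_top F"
  proof -
    have "filterlim (\<lambda>j. real (k j) / real (n j) * real (n j)) at_top F"
      by (rule filterlim_tendsto_pos_mult_at_top[OF kn p(1) nr])
    then show ?thesis
      by (rule filterlim_mono_eventually) (use n0 in \<open>auto elim: eventually_mono\<close>)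
  qed
  have nkr: "filterlim (\<lambda>j. real (n j) - real (k j)) at_top F"
  proof -
    have "filterlim (\<lambda>j. (1 - real (k j) / real (n j)) * real (n j)) at_top F"
      by (rule filterlim_tendsto_pos_mult_at_top[OF tendsto_diff[OF tendsto_const kn] _ nr])
        (use p in simp)
    then show ?thesis
      by (rule filterlim_mono_eventually)
        (use n0 in \<open>auto elim!: eventually_mono simp: field_simps\<close>)
  qed
  have inv0: "((\<lambda>j. c / real (n j)) \<longlongrightarrow> 0) F" for c
    by (rule real_tendsto_divide_at_top[OF tendsto_const nr])
  \<comment> \<open>After dividing numerator and denominator by \<open>n j\<close>, the constant
    shifts vanish in the limit.\<close>
  have shift: "((\<lambda>j. (real (k j) - s) / (real (n j) - d)) \<longlongrightarrow> p) F" for s d :: real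
  proof -
    have "((\<lambda>j. (real (k j) / real (n j) - s / real (n j)) / (1 - d / real (n j)))
             \<longlongrightarrow> (p - 0) / (1 - 0)) F"
      by (intro tendsto_intros kn inv0) simp
    then have "((\<lambda>j. (real (k j) / real (n j) - s / real (n j)) / (1 - d / real (n j)))
             \<longlongrightarrow> p) F"
      by simp
    moreover have "eventually (\<lambda>j. real (n j) > d) F"
      using nr by (auto simp: filterlim_at_top_dense)
    then have "eventually (\<lambda>j. (real (k j) / real (n j) - s / real (n j)) / (1 - d / real (n j))
        = (real (k j) - s) / (real (n j) - d)) F"
      using n0 by eventually_elim (simp add: field_simps)
    ultimately show ?thesis
      by (rule Lim_transform_eventually)
  qed
  show ?thesis
    using \<open>t \<le> m\<close>
  proof (induction m arbitrary: t)
    case 0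
    \<comment> \<open>With no fixed points the ratio is a number over itself;
      \<open>k j < n j\<close> excludes \<open>0 / 0\<close>.\<close>
    have "eventually (\<lambda>j. real (n j) - real (k j) > 0) F"
      using nkr unfolding filterlim_at_top_dense by blast
    then have "eventually (\<lambda>j. real (n j choose k j) / real (n j choose k j) = 1) F"
      by eventually_elim simp
    then show ?case
      using 0 by (simp add: tendsto_eventually)
  next
    case (Suc m)
    have ev: "eventually (\<lambda>j. real (k j) > real (Suc m) \<and> real (n j) - real (k j) > real (Suc m)) F"
      using kr nkr unfolding filterlim_at_top_dense by (intro eventually_conj) blast+
    show ?case
    \<comment> \<open>If \<open>t \<le> m\<close>, the new point can be chosen outside the trace and
      contributes the factor \<open>1 - p\<close>. Otherwise the trace consists of all
      \<open>Suc m\<close> points and the new one contributes \<open>p\<close>.\<close>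
    proof (cases "t \<le> m")
      case True
      have "((\<lambda>j. 1 - (real (k j) - real t) / (real (n j) - real m)) \<longlongrightarrow> 1 - p) F"
        by (intro tendsto_intros shift)
      from tendsto_mult[OF this Suc.IH[OF True]]
      have "((\<lambda>j. (1 - (real (k j) - real t) / (real (n j) - real m)) *
               (real ((n j - m) choose (k j - t)) / real (n j choose k j)))
               \<longlongrightarrow> p ^ t * (1 - p) ^ (Suc m - t)) F"
        using True by (simp add: Suc_diff_le mult_ac)
      moreover have "eventually (\<lambda>j. (1 - (real (k j) - real t) / (real (n j) - real m)) *
               (real ((n j - m) choose (k j - t)) / real (n j choose k j))
            = real ((n j - Suc m) choose (k j - t)) / real (n j choose k j)) F"
        using ev
      proof eventually_elim
        case (elim j)
        then have le: "Suc m < k j" "Suc m + k j < n j" by linarith+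
        define N where "N = n j - Suc m"
        have N: "n j - m = Suc N" "k j - t \<le> N" "real (n j) = real N + 1 + real m"
          using le by (auto simp: N_def)
        have r: "real (Suc N - (k j - t)) = (real (n j) - real m) - (real (k j) - real t)"
          using N le True by (simp add: of_nat_diff)
        have "real (N choose (k j - t)) / real (Suc N choose (k j - t))
            = 1 - (real (k j) - real t) / (real (n j) - real m)"
          unfolding binomial_ratio_Suc[OF N(2)] r using N(3)
          by (simp add: field_simps add_pos_nonneg[THEN less_imp_neq, symmetric])
        moreover have "Suc N choose (k j - t) > 0"
          using N(2) by (intro zero_less_binomial) simp
        ultimately show ?case
          unfolding N(1) N_def[symmetric] by (simp add: field_simps)
      qed
      ultimately show ?thesis
        by (rule Lim_transform_eventually)
    next
      case False
      then have t: "t = Suc m" using Suc.prems by simp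
      have "((\<lambda>j. (real (k j) - real m) / (real (n j) - real m)) \<longlongrightarrow> p) F"
        by (intro shift)
      from tendsto_mult[OF this Suc.IH[OF order_refl]]
      have "((\<lambda>j. ((real (k j) - real m) / (real (n j) - real m)) *
               (real ((n j - m) choose (k j - m)) / real (n j choose k j)))
               \<longlongrightarrow> p ^ t * (1 - p) ^ (Suc m - t)) F"
        by (simp add: t)
      moreover have "eventually (\<lambda>j. ((real (k j) - real m) / (real (n j) - real m)) *
               (real ((n j - m) choose (k j - m)) / real (n j choose k j))
            = real ((n j - Suc m) choose (k j - t)) / real (n j choose k j)) F"
        using ev
      proof eventually_elim
        case (elim j)
        then have le: "Suc m < k j" "Suc m + k j < n j" by linarith+
        define N K where "N = n j - Suc m" and "K = k j - Suc m"
        have N: "n j - m = Suc N" "k j - m = Suc K" "K \<le> N"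
          and r: "real (n j) - real m = real (Suc N)" "real (k j) - real m = real (Suc K)"
          using le by (auto simp: N_def K_def)
        have "Suc N choose Suc K > 0"
          using N(3) by (intro zero_less_binomial) simp
        then show ?case
          unfolding r N t N_def[symmetric] K_def[symmetric]
            binomial_ratio_Suc_Suc[OF N(3), symmetric] by (simp del: binomial_Suc_Suc)
      qed
      ultimately show ?thesis
        by (rule Lim_transform_eventually)
    qed
  qed
qed

section \<open>From the conjecture to an inequality for Bernoulli weights\<close>

text \<open>The \<open>k\<close>-sets supplied by the conjecture are sorted by their trace
  \<open>T\<close> on \<open>{1..m}\<close>, where all the weight sits. The condition
  \<open>m \<le> k\<close> ensures \<open>card T \<le> k\<close> for every trace.\<close>

lemma MMS_weight_inequality:
  fixes w :: "nat \<Rightarrow> real"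
  assumes MMS: "MMS_conjecture" and w: "(\<Sum>i=1..m. w i) = 1"
    and k: "m \<le> k" "0 < k" "4 * k \<le> n" and p: "p \<le> real k / real n"
  shows "(n - 1) choose (k - 1)
      \<le> (\<Sum>T | T \<subseteq> {1..m} \<and> p \<le> sum w T. (n - m) choose (k - card T))"
proof -
  \<comment> \<open>The shift by \<open>1 / n\<close> makes the total zero and lowers the weight of
    every \<open>k\<close>-set by exactly \<open>k / n\<close>.\<close>
  define x where "x i = (if i \<le> m then w i else 0) - 1 / real n" for i
  have sum_x: "sum x S = sum w (S \<inter> {1..m}) - real (card S) / real n" if "S \<subseteq> {1..n}" for S
  proof -
    have "finite S" using that by (rule finite_subset) simp
    have "(\<Sum>i\<in>S. if i \<le> m then w i else 0) = sum w (S \<inter> {1..m})"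
      using that \<open>finite S\<close> by (subst sum.inter_restrict) (auto intro!: sum.cong)
    then show ?thesis by (simp add: x_def sum_subtractf)
  qed
  have "m \<le> n" using k by simp
  have "(\<Sum>i=1..n. x i) = 0"
    using sum_x[of "{1..n}"] k w \<open>m \<le> n\<close> by (simp add: Int_absorb1)
  then have "(n - 1) choose (k - 1) \<le> card {S. S \<subseteq> {1..n} \<and> card S = k \<and> sum x S \<ge> 0}"
    using MMS k unfolding MMS_conjecture_def by simp
  \<comment> \<open>Inclusion is enough here: when \<open>p < k / n\<close>, the union may also
    contain sets with negative \<open>x\<close>-sum.\<close>
  also have "\<dots> \<le> card (\<Union>T\<in>{T. T \<subseteq> {1..m} \<and> p \<le> sum w T}.
      {S. S \<subseteq> {1..n} \<and> card S = k \<and> S \<inter> {1..m} = T})"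
  proof (rule card_mono)
    show "finite (\<Union>T\<in>{T. T \<subseteq> {1..m} \<and> p \<le> sum w T}.
        {S. S \<subseteq> {1..n} \<and> card S = k \<and> S \<inter> {1..m} = T})"
      by (rule finite_subset[of _ "Pow {1..n}"]) auto
    show "{S. S \<subseteq> {1..n} \<and> card S = k \<and> sum x S \<ge> 0}
        \<subseteq> (\<Union>T\<in>{T. T \<subseteq> {1..m} \<and> p \<le> sum w T}.
              {S. S \<subseteq> {1..n} \<and> card S = k \<and> S \<inter> {1..m} = T})"
    proof clarify
      fix S assume S: "S \<subseteq> {1..n}" "0 \<le> sum x S" "k = card S"
      then have "p \<le> sum w (S \<inter> {1..m})"
        using sum_x[OF S(1)] p by simp
      then show "S \<in> (\<Union>T\<in>{T. T \<subseteq> {1..m} \<and> p \<le> sum w T}.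
          {S'. S' \<subseteq> {1..n} \<and> card S' = card S \<and> S' \<inter> {1..m} = T})"
        using S by auto
    qed
  qed
  also have "\<dots> \<le> (\<Sum>T | T \<subseteq> {1..m} \<and> p \<le> sum w T.
      card {S. S \<subseteq> {1..n} \<and> card S = k \<and> S \<inter> {1..m} = T})"
    by (rule card_UN_le) simp
  also have "\<dots> = (\<Sum>T | T \<subseteq> {1..m} \<and> p \<le> sum w T. (n - m) choose (k - card T))"
  proof (intro sum.cong refl)
    fix T assume "T \<in> {T. T \<subseteq> {1..m} \<and> p \<le> sum w T}"
    then have T: "T \<subseteq> {1..m}" by simp
    have "card T \<le> m" using card_mono[OF _ T] by simp
    moreover have "card ({1..n} - {1..m}) = n - m"
      using \<open>m \<le> n\<close> by (subst card_Diff_subset) auto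
    ultimately show "card {S. S \<subseteq> {1..n} \<and> card S = k \<and> S \<inter> {1..m} = T}
        = (n - m) choose (k - card T)"
      using card_subsets_with_trace[of "{1..n}" "{1..m}" T k] T k \<open>m \<le> n\<close> by simp
  qed
  finally show ?thesis .
qed

text \<open>After division by \<open>n choose k\<close> the counting inequality has left side
  \<open>k / n\<close>, which tends to \<open>p\<close>. The right side is a finite sum over traces,
  so its limit is taken term by term.\<close>

lemma MMS_bernoulli_weight_inequality:
  fixes w :: "nat \<Rightarrow> real"
  assumes MMS: "MMS_conjecture" and w: "(\<Sum>i=1..m. w i) = 1" and p: "0 < p" "p \<le> 1 / 4"
  shows "p \<le> (\<Sum>T | T \<subseteq> {1..m} \<and> p \<le> sum w T. p ^ card T * (1 - p) ^ (m - card T))"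
proof -
  define n where "n j = 4 * j" for j :: nat
  define k where "k j = nat \<lceil>p * real (n j)\<rceil>" for j
  have k_ge: "p * real (n j) \<le> real (k j)" for j
    unfolding k_def by (rule of_nat_ceiling)
  have k_less: "real (k j) < p * real (n j) + 1" for j
  proof -
    \<comment> \<open>Nonnegativity of the ceiling means that \<open>nat\<close> does not truncate
      it.\<close>
    have "0 \<le> \<lceil>p * real (n j)\<rceil>" using p by (simp add: order_less_le_trans[of "-1" 0])
    then show ?thesis unfolding k_def by (simp, linarith)
  qed
  have n4: "4 * k j \<le> n j" for j
  proof -
    \<comment> \<open>The bound \<open>j\<close> is an integer, so it survives rounding up, even at
      \<open>p = 1/4\<close>.\<close>
    have "p * real (n j) \<le> real j" using p(2) mult_right_mono[of p "1/4" "real (n j)"]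
      by (simp add: n_def)
    then have "\<lceil>p * real (n j)\<rceil> \<le> int j" by (simp add: ceiling_le_iff)
    then have "k j \<le> j" unfolding k_def by linarith
    then show ?thesis by (simp add: n_def)
  qed
  have n: "filterlim n at_top sequentially"
    unfolding n_def by (rule filterlim_subseq) (simp add: strict_mono_def)
  have nr: "filterlim (\<lambda>j. real (n j)) at_top sequentially"
    using filterlim_compose[OF filterlim_real_sequentially n] .
  have kn_ge: "p \<le> real (k j) / real (n j)" if "j > 0" for j
    using k_ge[of j] that by (simp add: n_def field_simps)
  have kn: "(\<lambda>j. real (k j) / real (n j)) \<longlonglongrightarrow> p"
  proof (rule tendsto_sandwich)
    show "(\<lambda>_. p) \<longlonglongrightarrow> p" by simp
    have "(\<lambda>j. 1 / real (n j)) \<longlonglongrightarrow> 0"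
      by (rule real_tendsto_divide_at_top[OF tendsto_const nr])
    from tendsto_add[OF tendsto_const[of p] this]
    show "(\<lambda>j. p + 1 / real (n j)) \<longlonglongrightarrow> p" by simp
    show "eventually (\<lambda>j. p \<le> real (k j) / real (n j)) sequentially"
      using eventually_gt_at_top[of 0] by eventually_elim (rule kn_ge)
    show "eventually (\<lambda>j. real (k j) / real (n j) \<le> p + 1 / real (n j)) sequentially"
      using eventually_gt_at_top[of 0]
    proof eventually_elim
      case (elim j)
      then show ?case using k_less[of j] by (simp add: n_def field_simps)
    qed
  qed
  have "filterlim (\<lambda>j. p * real (n j)) at_top sequentially"
    by (rule filterlim_tendsto_pos_mult_at_top[OF tendsto_const p(1) nr])
  then have big: "eventually (\<lambda>j. p * real (n j) > real m) sequentially"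
    by (auto simp: filterlim_at_top_dense)
  show ?thesis
  proof (rule tendsto_le[OF _ _ kn])
    show "(\<lambda>j. \<Sum>T | T \<subseteq> {1..m} \<and> p \<le> sum w T.
            real ((n j - m) choose (k j - card T)) / real (n j choose k j))
        \<longlonglongrightarrow> (\<Sum>T | T \<subseteq> {1..m} \<and> p \<le> sum w T. p ^ card T * (1 - p) ^ (m - card T))"
    proof (intro tendsto_sum binomial_ratio_tendsto n kn)
      fix T assume "T \<in> {T. T \<subseteq> {1..m} \<and> p \<le> sum w T}"
      then show "card T \<le> m" using card_mono[of "{1..m}" T] by simp
    qed (use p in auto)
    show "eventually (\<lambda>j. real (k j) / real (n j) \<le>
        (\<Sum>T | T \<subseteq> {1..m} \<and> p \<le> sum w T.
            real ((n j - m) choose (k j - card T)) / real (n j choose k j))) sequentially"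
      using big eventually_gt_at_top[of 0]
    proof eventually_elim
      case (elim j)
      have k: "m < k j" using elim k_ge[of j] by linarith
      define N K where "N = n j - 1" and "K = k j - 1"
      have NK: "n j = Suc N" "k j = Suc K" "K \<le> N"
        using k n4[of j] by (auto simp: N_def K_def)
      \<comment> \<open>Absorption turns the number of sets guaranteed by the conjecture into the
        proportion \<open>k j / n j\<close>.\<close>
      have "real (k j) / real (n j) = real ((n j - 1) choose (k j - 1)) / real (n j choose k j)"
        unfolding NK using binomial_ratio_Suc_Suc[OF NK(3)] by simp
      also have "\<dots> \<le> real (\<Sum>T | T \<subseteq> {1..m} \<and> p \<le> sum w T.
          (n j - m) choose (k j - card T)) / real (n j choose k j)"
        using k n4[of j] kn_ge[of j] elim
        by (intro divide_right_mono of_nat_mono MMS_weight_inequality MMS w) auto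
      finally show ?case by (simp add: sum_divide_distrib)
    qed
  qed simp
qed

section \<open>The law of a weighted sum of independent Bernoulli variables\<close>

text \<open>The event is split by the set \<open>T\<close> of coordinates equal to 1. On each piece
  the sum is the constant \<open>sum w T\<close>, and independence makes the probability of the
  piece a product.\<close>

lemma (in prob_space) prob_weighted_bernoulli_sum:
  fixes w :: "'i \<Rightarrow> real"
  assumes I: "finite I" "I \<noteq> {}"
    and indep: "indep_vars (\<lambda>_. borel) v I"
    and bern: "\<And>i. i \<in> I \<Longrightarrow> bernoulli_var M p (v i)"
  shows "prob {\<omega> \<in> space M. (\<Sum>i\<in>I. w i * v i \<omega>) \<ge> c}
      = (\<Sum>T | T \<subseteq> I \<and> c \<le> sum w T. p ^ card T * (1 - p) ^ (card I - card T))"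
proof -
  define E where "E T = (\<Inter>i\<in>I. v i -` {indicator T i} \<inter> space M)" for T :: "'i set"
  have E_iff: "\<omega> \<in> E T \<longleftrightarrow> \<omega> \<in> space M \<and> (\<forall>i\<in>I. v i \<omega> = indicator T i)" for \<omega> T
    using I by (auto simp: E_def)
  have v01: "v i \<omega> = 0 \<or> v i \<omega> = 1" if "i \<in> I" "\<omega> \<in> space M" for i \<omega>
    using bern[OF that(1)] that(2) by (auto simp: bernoulli_var_def)
  have E_sets: "E T \<in> events" for T
    unfolding E_def using I bern
    by (intro sets.finite_INT measurable_sets[where A = borel])
      (auto simp: bernoulli_var_def)
  have disj: "disjoint_family_on E {T. T \<subseteq> I \<and> c \<le> sum w T}"
  proof (unfold disjoint_family_on_def, intro ballI impI)
    fix S T assume ST: "S \<in> {T. T \<subseteq> I \<and> c \<le> sum w T}" "T \<in> {T. T \<subseteq> I \<and> c \<le> sum w T}" "S \<noteq> T"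
    then obtain i where "i \<in> I" "i \<in> S \<longleftrightarrow> i \<notin> T"
      by blast
    then have "i \<in> I" "(indicator S i :: real) \<noteq> indicator T i"
      by (auto simp: indicator_def)
    then show "E S \<inter> E T = {}" by (auto simp: E_iff)
  qed
  have E_prob: "prob (E T) = p ^ card T * (1 - p) ^ (card I - card T)" if T: "T \<subseteq> I" for T
  proof -
    have "prob (E T) = (\<Prod>i\<in>I. prob (v i -` {indicator T i} \<inter> space M))"
      unfolding E_def using I by (intro indep_varsD[OF indep]) auto
    also have "\<dots> = (\<Prod>i\<in>I. if i \<in> T then p else 1 - p)"
    proof (intro prod.cong refl)
      fix i assume "i \<in> I"
      moreover have "v i -` {y} \<inter> space M = {\<omega> \<in> space M. v i \<omega> = y}" for y by auto
      ultimately show "prob (v i -` {indicator T i} \<inter> space M) = (if i \<in> T then p else 1 - p)"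
        using bern[of i] by (auto simp: bernoulli_var_def)
    qed
    also have "\<dots> = p ^ card T * (1 - p) ^ card (I - T)"
    proof -
      have "I \<inter> {i. i \<in> T} = T" "I \<inter> - {i. i \<in> T} = I - T" using T by auto
      then show ?thesis using I(1) by (simp add: prod.If_cases)
    qed
    also have "card (I - T) = card I - card T"
      using T I by (intro card_Diff_subset) (auto intro: finite_subset)
    finally show ?thesis .
  qed
  have sum_E: "(\<Sum>i\<in>I. w i * v i \<omega>) = sum w T" if "\<omega> \<in> E T" "T \<subseteq> I" for \<omega> T
  proof -
    have "(\<Sum>i\<in>I. w i * v i \<omega>) = (\<Sum>i\<in>I. w i * indicator T i)"
      using that by (intro sum.cong) (auto simp: E_iff)
    also have "\<dots> = sum w T"
      using that I by (simp add: indicator_def sum.If_cases Int_absorb1 if_distrib)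
    finally show ?thesis .
  qed
  \<comment> \<open>The pieces cover the event exactly, not merely up to a null set, because the
    coordinates take values in \<open>{0, 1}\<close> at every point of the space.\<close>
  have "{\<omega> \<in> space M. (\<Sum>i\<in>I. w i * v i \<omega>) \<ge> c} = (\<Union>T\<in>{T. T \<subseteq> I \<and> c \<le> sum w T}. E T)"
  proof (intro equalityI subsetI)
    fix \<omega> assume \<omega>: "\<omega> \<in> {\<omega> \<in> space M. (\<Sum>i\<in>I. w i * v i \<omega>) \<ge> c}"
    define T where "T = {i\<in>I. v i \<omega> = 1}"
    have "\<omega> \<in> E T" "T \<subseteq> I"
      using \<omega> v01 by (auto simp: E_iff T_def indicator_def)
    then show "\<omega> \<in> (\<Union>T\<in>{T. T \<subseteq> I \<and> c \<le> sum w T}. E T)"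
      using sum_E[of \<omega> T] \<omega> by auto
  next
    fix \<omega> assume "\<omega> \<in> (\<Union>T\<in>{T. T \<subseteq> I \<and> c \<le> sum w T}. E T)"
    then show "\<omega> \<in> {\<omega> \<in> space M. (\<Sum>i\<in>I. w i * v i \<omega>) \<ge> c}"
      using sum_E by (auto simp: E_iff)
  qed
  then have "prob {\<omega> \<in> space M. (\<Sum>i\<in>I. w i * v i \<omega>) \<ge> c}
      = (\<Sum>T | T \<subseteq> I \<and> c \<le> sum w T. prob (E T))"
    using I E_sets disj by (simp add: finite_measure_finite_Union image_subset_iff)
  then show ?thesis by (simp add: E_prob)
qed

theorem mainTheorem3:
  fixes M :: "'a measure" and p :: real and m :: nat
    and w :: "nat \<Rightarrow> real" and v :: "nat \<Rightarrow> 'a \<Rightarrow> real"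
  assumes "MMS_conjecture"
    and "0 \<le> p" and "p \<le> 1/4"
    and "m > 0"
    and "\<And>i. i \<in> {1..m} \<Longrightarrow> w i > 0"
    and "(\<Sum>i=1..m. w i) = 1"
    and "prob_space M"
    and "prob_space.indep_vars M (\<lambda>_. borel) v {1..m}"
    and "\<And>i. i \<in> {1..m} \<Longrightarrow> bernoulli_var M p (v i)"
  shows "measure M {\<omega> \<in> space M. (\<Sum>i=1..m. w i * v i \<omega>) \<ge> p} \<ge> p"
proof (cases "p = 0")
  case True
  \<comment> \<open>Here the bound is nonnegativity of the measure. The case is separate because the
    limit argument uses \<open>p > 0\<close> to make \<open>k j\<close> unbounded.\<close>
  then show ?thesis by simp
next
  case False
  interpret prob_space M by fact
  have "prob {\<omega> \<in> space M. (\<Sum>i=1..m. w i * v i \<omega>) \<ge> p}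
      = (\<Sum>T | T \<subseteq> {1..m} \<and> p \<le> sum w T. p ^ card T * (1 - p) ^ (card {1..m} - card T))"
    using assms(4,8,9) by (intro prob_weighted_bernoulli_sum) auto
  then show ?thesis
    using MMS_bernoulli_weight_inequality[OF assms(1,6), of p] False assms(2,3) by simp
qed

end
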